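(* Let $p$ be a prime and let $\Gamma(D_{2p^2})$ be the intersection graph of the dihedral group $D_{2p^2}$. Then the number of edges of $\Gamma(D_{2p^2})$ is $|E(\Gamma(D_{2p^2}))|=\frac{1}{2}(3p^2+3p+2)$.
   Context: For an integer $n\ge 3$, $D_{2n}=\langle r,s : r^n=s^2=1,\ srs=r^{-1}\rangle$ is the dihedral group of order $2n$. For a finite group $G$, the intersection graph $\Gamma(G)$ is the simple undirected graph whose vertex set is the set of all proper non-trivial subgroups of $G$, with two distinct vertices $H,K$ adjacent if and only if $H\cap K\neq\{e\}$, where $e$ is the identity of $G$. *)

theory Defs
  imports Complex_Main "HOL-Algebra.Coset" "HOL-Computational_Algebra.Primes"
begin

section \<open>Groups given by generators and relations\<close>

text \<open>The letter \<open>(x, True)\<close> stands for the generator \<open>x\<close>, and \<open>(x, False)\<close> for its formal inverse.\<close>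

type_synonym 'x word = "('x \<times> bool) list"

text \<open>Equality of words in the group generated by all elements of the type \<open>'x\<close>, subject to the
  relations \<open>u = v\<close> for \<open>(u, v) \<in> R\<close>: the least congruence for concatenation that contains \<open>R\<close>
  and cancels mutually inverse letters.\<close>

inductive word_eq :: "('x word \<times> 'x word) set \<Rightarrow> 'x word \<Rightarrow> 'x word \<Rightarrow> bool"
  for R :: "('x word \<times> 'x word) set" where
  refl: "word_eq R u u"
| sym: "word_eq R u v \<Longrightarrow> word_eq R v u"
| trans: "word_eq R u v \<Longrightarrow> word_eq R v w \<Longrightarrow> word_eq R u w"
| append: "word_eq R u v \<Longrightarrow> word_eq R u' v' \<Longrightarrow> word_eq R (u @ u') (v @ v')"
| cancel: "word_eq R [(x, b), (x, \<not> b)] []"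
| relation: "(u, v) \<in> R \<Longrightarrow> word_eq R u v"

definition word_class :: "('x word \<times> 'x word) set \<Rightarrow> 'x word \<Rightarrow> 'x word set" where
  "word_class R u = {v. word_eq R u v}"

definition presented_group :: "('x word \<times> 'x word) set \<Rightarrow> 'x word set monoid" where
  "presented_group R =
     \<lparr>carrier = range (word_class R),
      monoid.mult = (\<lambda>A B. \<Union>u\<in>A. \<Union>v\<in>B. word_class R (u @ v)),
      one = word_class R []\<rparr>"

lemma word_class_eq_iff: "word_class R u = word_class R v \<longleftrightarrow> word_eq R u v"
  unfolding word_class_def by (auto intro: word_eq.intros)

lemma word_class_mult:
  "word_class R u \<otimes>\<^bsub>presented_group R\<^esub> word_class R v = word_class R (u @ v)"
proof -
  have "word_class R (u' @ v') = word_class R (u @ v)"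
    if "u' \<in> word_class R u" "v' \<in> word_class R v" for u' v'
    using that unfolding word_class_eq_iff
    by (auto simp: word_class_def intro: word_eq.append word_eq.sym)
  moreover have "u \<in> word_class R u" "v \<in> word_class R v"
    by (auto simp: word_class_def intro: word_eq.refl)
  ultimately have "(\<Union>u'\<in>word_class R u. \<Union>v'\<in>word_class R v. word_class R (u' @ v')) = word_class R (u @ v)"
    by blast
  then show ?thesis
    by (simp add: presented_group_def)
qed

definition inverse_word :: "'x word \<Rightarrow> 'x word" where
  "inverse_word u = rev (map (\<lambda>(x, b). (x, \<not> b)) u)"

lemma word_eq_inverse_word: "word_eq R (inverse_word u @ u) []"
proof (induction u)
  case Nil
  then show ?case by (simp add: inverse_word_def word_eq.refl)
next
  case (Cons a u)
  obtain x b where a: "a = (x, b)" by force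
  have "word_eq R (inverse_word u @ [(x, \<not> b), (x, b)] @ u) (inverse_word u @ [] @ u)"
    using word_eq.cancel[of R x "\<not> b"] by (intro word_eq.append word_eq.refl) simp
  then have "word_eq R (inverse_word (a # u) @ a # u) (inverse_word u @ u)"
    by (simp add: a inverse_word_def)
  then show ?case
    using Cons.IH by (rule word_eq.trans)
qed

lemma group_presented_group: "group (presented_group R)"
proof (rule groupI)
  fix A assume "A \<in> carrier (presented_group R)"
  then obtain u where u: "A = word_class R u" by (auto simp: presented_group_def)
  have "word_class R (inverse_word u) \<otimes>\<^bsub>presented_group R\<^esub> A = \<one>\<^bsub>presented_group R\<^esub>"
    using word_eq_inverse_word[of R u]
    by (simp add: u word_class_mult) (simp add: presented_group_def word_class_eq_iff)
  then show "\<exists>B\<in>carrier (presented_group R). B \<otimes>\<^bsub>presented_group R\<^esub> A = \<one>\<^bsub>presented_group R\<^esub>"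
    by (auto simp: presented_group_def)
next
  have one: "\<one>\<^bsub>presented_group R\<^esub> = word_class R []" by (simp add: presented_group_def)
  have car: "carrier (presented_group R) = range (word_class R)" by (simp add: presented_group_def)
  show "\<one>\<^bsub>presented_group R\<^esub> \<in> carrier (presented_group R)" by (simp add: one car)
  show "\<And>A B. A \<in> carrier (presented_group R) \<Longrightarrow> B \<in> carrier (presented_group R)
          \<Longrightarrow> A \<otimes>\<^bsub>presented_group R\<^esub> B \<in> carrier (presented_group R)"
    by (auto simp: car word_class_mult)
  show "\<And>A. A \<in> carrier (presented_group R) \<Longrightarrow> \<one>\<^bsub>presented_group R\<^esub> \<otimes>\<^bsub>presented_group R\<^esub> A = A"
    by (auto simp: one car word_class_mult)
  show "\<And>A B C. A \<in> carrier (presented_group R) \<Longrightarrow> B \<in> carrier (presented_group R) \<Longrightarrow>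
          C \<in> carrier (presented_group R) \<Longrightarrow>
          A \<otimes>\<^bsub>presented_group R\<^esub> B \<otimes>\<^bsub>presented_group R\<^esub> C =
          A \<otimes>\<^bsub>presented_group R\<^esub> (B \<otimes>\<^bsub>presented_group R\<^esub> C)"
    by (auto simp: car word_class_mult)
qed

section \<open>Dihedral groups\<close>

datatype dihedral_gen = Rot | Ref

text \<open>The relations \<open>r\<^sup>n = 1\<close>, \<open>s\<^sup>2 = 1\<close> and \<open>s r s = r\<^sup>-\<^sup>1\<close>, where \<open>r = Rot\<close> and \<open>s = Ref\<close>.\<close>

definition dihedral_relations :: "nat \<Rightarrow> (dihedral_gen word \<times> dihedral_gen word) set" where
  "dihedral_relations n =
     {(replicate n (Rot, True), []),
      (replicate 2 (Ref, True), []),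
      ([(Ref, True), (Rot, True), (Ref, True)], [(Rot, False)])}"

text \<open>The parameter \<open>n\<close> is half the order: this is the group of order \<open>2 * n\<close>.\<close>

definition dihedral_group :: "nat \<Rightarrow> dihedral_gen word set monoid" where
  "dihedral_group n = presented_group (dihedral_relations n)"

lemma order_dihedral_group:
  assumes "n \<ge> 3"
  shows "order (dihedral_group n) = 2 * n"
proof -
  let ?R = "dihedral_relations n" and ?D = "dihedral_group n"
  let ?c = "word_class (dihedral_relations n)"
  interpret group ?D
    unfolding dihedral_group_def by (rule group_presented_group)
  define r where "r = ?c [(Rot, True)]"
  define s where "s = ?c [(Ref, True)]"
  have car: "carrier ?D = range ?c"
    by (simp add: dihedral_group_def presented_group_def)
  have one: "\<one>\<^bsub>?D\<^esub> = ?c []"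
    by (simp add: dihedral_group_def presented_group_def)
  have mult: "?c u \<otimes>\<^bsub>?D\<^esub> ?c v = ?c (u @ v)" for u v
    by (simp add: dihedral_group_def word_class_mult)
  have rel: "?c u = ?c v" if "(u, v) \<in> ?R" for u v
    using that by (simp add: word_class_eq_iff word_eq.relation)
  have rc [simp]: "r \<in> carrier ?D" and sc [simp]: "s \<in> carrier ?D"
    by (auto simp: r_def s_def car)
  have pow: "?c [a] [^]\<^bsub>?D\<^esub> (i::nat) = ?c (replicate i a)" for a i
    by (induction i) (simp_all add: one mult replicate_append_same)
  have rn: "r [^]\<^bsub>?D\<^esub> n = \<one>\<^bsub>?D\<^esub>"
    unfolding r_def pow one by (rule rel) (simp add: dihedral_relations_def)
  have ss: "s \<otimes>\<^bsub>?D\<^esub> s = \<one>\<^bsub>?D\<^esub>"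
    unfolding s_def mult one
    by (rule rel) (simp add: dihedral_relations_def numeral_2_eq_2)
  have canc: "?c [(x, b)] \<otimes>\<^bsub>?D\<^esub> ?c [(x, \<not> b)] = \<one>\<^bsub>?D\<^esub>" for x b
    unfolding mult one word_class_eq_iff by (simp add: word_eq.cancel)
  have r_inv: "?c [(Rot, False)] = inv\<^bsub>?D\<^esub> r"
    using canc[of Rot False] by (intro inv_equality[symmetric]) (auto simp: r_def car)
  have s_inv: "?c [(Ref, False)] = s"
    using canc[of Ref False] inv_equality[of "?c [(Ref, False)]" s] inv_equality[OF ss]
    by (auto simp: s_def car)
  have srs: "s \<otimes>\<^bsub>?D\<^esub> r \<otimes>\<^bsub>?D\<^esub> s = inv\<^bsub>?D\<^esub> r"
    unfolding r_inv[symmetric] unfolding r_def s_def mult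
    by (rule rel) (simp add: dihedral_relations_def)
  have r_inv_pow: "inv\<^bsub>?D\<^esub> r = r [^]\<^bsub>?D\<^esub> (n - 1)"
  proof (rule inv_equality)
    show "r [^]\<^bsub>?D\<^esub> (n - 1) \<otimes>\<^bsub>?D\<^esub> r = \<one>\<^bsub>?D\<^esub>"
      using rn assms by (cases n) simp_all
  qed simp_all
  have sr: "s \<otimes>\<^bsub>?D\<^esub> r = r [^]\<^bsub>?D\<^esub> (n - 1) \<otimes>\<^bsub>?D\<^esub> s"
    using srs ss unfolding r_inv_pow by (metis m_assoc m_closed r_one rc sc)
  have srp: "s \<otimes>\<^bsub>?D\<^esub> r [^]\<^bsub>?D\<^esub> i = r [^]\<^bsub>?D\<^esub> ((n - 1) * i) \<otimes>\<^bsub>?D\<^esub> s" for i :: nat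
  proof (induction i)
    case (Suc i)
    have "s \<otimes>\<^bsub>?D\<^esub> r [^]\<^bsub>?D\<^esub> Suc i = (s \<otimes>\<^bsub>?D\<^esub> r [^]\<^bsub>?D\<^esub> i) \<otimes>\<^bsub>?D\<^esub> r"
      by (simp add: m_assoc)
    also have "\<dots> = r [^]\<^bsub>?D\<^esub> ((n - 1) * i) \<otimes>\<^bsub>?D\<^esub> (s \<otimes>\<^bsub>?D\<^esub> r)"
      by (simp only: Suc.IH) (simp add: m_assoc)
    also have "\<dots> = r [^]\<^bsub>?D\<^esub> ((n - 1) * i) \<otimes>\<^bsub>?D\<^esub> r [^]\<^bsub>?D\<^esub> (n - 1) \<otimes>\<^bsub>?D\<^esub> s"
      by (simp add: sr m_assoc)
    also have "\<dots> = r [^]\<^bsub>?D\<^esub> ((n - 1) * Suc i) \<otimes>\<^bsub>?D\<^esub> s"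
      by (simp add: nat_pow_mult add.commute)
    finally show ?case .
  qed simp
  define f where "f = (\<lambda>(i::nat, j::nat). r [^]\<^bsub>?D\<^esub> i \<otimes>\<^bsub>?D\<^esub> s [^]\<^bsub>?D\<^esub> j)"
  have norm: "\<exists>i j. ?c w = f (i, j)" for w
  proof (induction w)
    case Nil
    have "?c [] = f (0, 0)" by (simp add: f_def one mult)
    then show ?case by blast
  next
    case (Cons a w)
    then obtain i j where ij: "?c w = f (i, j)" by blast
    have step: "?c (a # w) = ?c [a] \<otimes>\<^bsub>?D\<^esub> f (i, j)"
      by (simp add: ij[symmetric] mult)
    have R: "r [^]\<^bsub>?D\<^esub> (k::nat) \<otimes>\<^bsub>?D\<^esub> f (i, j) = f (k + i, j)" for k
      by (simp add: f_def m_assoc[symmetric] nat_pow_mult)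
    have S: "s \<otimes>\<^bsub>?D\<^esub> f (i, j) = f ((n - 1) * i, Suc j)"
    proof -
      have "s \<otimes>\<^bsub>?D\<^esub> f (i, j) = (s \<otimes>\<^bsub>?D\<^esub> r [^]\<^bsub>?D\<^esub> i) \<otimes>\<^bsub>?D\<^esub> s [^]\<^bsub>?D\<^esub> j"
        by (simp add: f_def m_assoc)
      also have "\<dots> = r [^]\<^bsub>?D\<^esub> ((n - 1) * i) \<otimes>\<^bsub>?D\<^esub> (s \<otimes>\<^bsub>?D\<^esub> s [^]\<^bsub>?D\<^esub> j)"
        by (simp add: srp m_assoc)
      also have "s \<otimes>\<^bsub>?D\<^esub> s [^]\<^bsub>?D\<^esub> j = s [^]\<^bsub>?D\<^esub> Suc j"
        using nat_pow_mult[of s 1 j] by simp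
      finally show ?thesis by (simp add: f_def)
    qed
    obtain x b where a: "a = (x, b)" by force
    show ?case
    proof (cases x)
      case Rot
      then show ?thesis
        using step a R[of 1] R[of "n - 1"] r_inv r_inv_pow by (cases b) (auto simp: r_def[symmetric])
    next
      case Ref
      then have "?c [a] = s" using a s_inv by (cases b) (auto simp: s_def)
      then show ?thesis using step S by auto
    qed
  qed
  have f_mod: "f (i, j) = f (i mod n, j mod 2)" for i j
  proof -
    have "r [^]\<^bsub>?D\<^esub> i = r [^]\<^bsub>?D\<^esub> (n * (i div n) + i mod n)" by simp
    also have "\<dots> = (r [^]\<^bsub>?D\<^esub> n) [^]\<^bsub>?D\<^esub> (i div n) \<otimes>\<^bsub>?D\<^esub> r [^]\<^bsub>?D\<^esub> (i mod n)"
      by (simp only: nat_pow_mult[symmetric] nat_pow_pow rc)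
    finally have 1: "r [^]\<^bsub>?D\<^esub> i = r [^]\<^bsub>?D\<^esub> (i mod n)" by (simp add: rn)
    have "s [^]\<^bsub>?D\<^esub> j = s [^]\<^bsub>?D\<^esub> (2 * (j div 2) + j mod 2)" by simp
    also have "\<dots> = (s [^]\<^bsub>?D\<^esub> (2::nat)) [^]\<^bsub>?D\<^esub> (j div 2) \<otimes>\<^bsub>?D\<^esub> s [^]\<^bsub>?D\<^esub> (j mod 2)"
      by (simp only: nat_pow_mult[symmetric] nat_pow_pow sc)
    finally have 2: "s [^]\<^bsub>?D\<^esub> j = s [^]\<^bsub>?D\<^esub> (j mod 2)"
      by (simp add: ss numeral_2_eq_2)
    show ?thesis unfolding f_def prod.case using 1 2 by argo
  qed
  have carf: "carrier ?D = f ` ({..<n} \<times> {..<2})"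
  proof
    show "carrier ?D \<subseteq> f ` ({..<n} \<times> {..<2})"
    proof
      fix A assume "A \<in> carrier ?D"
      then obtain i j where "A = f (i, j)" using norm car by (metis imageE)
      then have "A = f (i mod n, j mod 2)" using f_mod[of i j] by metis
      moreover have "(i mod n, j mod 2) \<in> {..<n} \<times> {..<2}" using assms by auto
      ultimately show "A \<in> f ` ({..<n} \<times> {..<2})" by blast
    qed
    show "f ` ({..<n} \<times> {..<2}) \<subseteq> carrier ?D"
      by (auto simp: f_def)
  qed
  define letter :: "dihedral_gen \<times> bool \<Rightarrow> int \<Rightarrow> int" where
    "letter = (\<lambda>(x, b) k. case x of Rot \<Rightarrow> (if b then k + 1 else k - 1) | Ref \<Rightarrow> - k)"
  define act :: "dihedral_gen word \<Rightarrow> int \<Rightarrow> int" where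
    "act w = foldr letter w" for w
  have act_append: "act (u @ v) k = act u (act v k)" for u v k
    by (simp add: act_def)
  have letter_cong: "letter a k mod int n = letter a l mod int n" if "k mod int n = l mod int n" for a k l
    using that unfolding letter_def
    by (auto split: prod.split dihedral_gen.split intro: mod_add_cong mod_diff_cong mod_minus_cong)
  have act_cong: "act w k mod int n = act w l mod int n" if "k mod int n = l mod int n" for w k l
    using that by (induction w) (auto simp: act_def intro: letter_cong)
  have act_r: "act (replicate i (Rot, True)) k = k + int i" for i k
    by (induction i) (auto simp: act_def letter_def)
  have act_eq: "act u k mod int n = act v k mod int n" if "word_eq ?R u v" for u v k
    using that
  proof (induction arbitrary: k rule: word_eq.induct)
    case (append u v u' v')
    then show ?case by (metis act_append act_cong)
  next
    case (cancel x b)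
    show ?case by (cases x) (auto simp: act_def letter_def)
  next
    case (relation u v)
    then consider "u = replicate n (Rot, True)" "v = []"
      | "u = replicate 2 (Ref, True)" "v = []"
      | "u = [(Ref, True), (Rot, True), (Ref, True)]" "v = [(Rot, False)]"
      by (auto simp: dihedral_relations_def)
    then show ?case
    proof cases
      case 1
      then show ?thesis by (simp add: act_r) (simp add: act_def)
    qed (auto simp: act_def letter_def numeral_2_eq_2)
  qed auto
  have f_word: "f (i, j) = ?c (replicate i (Rot, True) @ replicate j (Ref, True))" for i j
    by (simp add: f_def r_def s_def pow mult)
  have "inj_on f ({..<n} \<times> {..<2})"
  proof (rule inj_onI)
    fix x y
    assume xy: "x \<in> {..<n} \<times> {..<2}" "y \<in> {..<n} \<times> {..<2}" "f x = f y"
    obtain i j i' j' where x: "x = (i, j)" and y: "y = (i', j')" by fastforce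
    have b: "i \<in> {..<n}" "j \<in> {..<2::nat}" "i' \<in> {..<n}" "j' \<in> {..<2::nat}"
      and "f (i, j) = f (i', j')"
      using xy by (auto simp: x y)
    then have e: "act (replicate i (Rot, True) @ replicate j (Ref, True)) k mod int n
        = act (replicate i' (Rot, True) @ replicate j' (Ref, True)) k mod int n" for k
      by (intro act_eq) (simp add: f_word word_class_eq_iff)
    have act_s: "act (replicate j (Ref, True)) k = (if j = 0 then k else - k)" if "j < 2" for j k
      using that by (cases j) (auto simp: act_def letter_def)
    have i: "i = i'" using e[of 0] b by (auto simp: act_append act_r act_s split: if_splits)
    have False if "j \<noteq> j'"
    proof -
      have "(1 + int i) mod int n = (-1 + int i) mod int n"
        using e[of 1] that b i by (auto simp: act_append act_r act_s split: if_splits)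
      then have "int n dvd 2" by (simp add: mod_eq_dvd_iff)
      then show False using assms by (auto dest: zdvd_imp_le)
    qed
    then show "x = y" using i x y by blast
  qed
  then show ?thesis
    by (simp add: order_def carf card_image)
qed

section \<open>The intersection graph of a group\<close>

text \<open>A simple undirected graph is given by its vertex set and its set of edges, an edge being the
  two-element set of its end points.\<close>

type_synonym 'v ugraph = "'v set \<times> 'v set set"

definition ugraph_verts :: "'v ugraph \<Rightarrow> 'v set" where
  "ugraph_verts = fst"

definition ugraph_edges :: "'v ugraph \<Rightarrow> 'v set set" where
  "ugraph_edges = snd"

definition proper_nontrivial_subgroups :: "('a, 'b) monoid_scheme \<Rightarrow> 'a set set" where
  "proper_nontrivial_subgroups G = {H. subgroup H G \<and> H \<noteq> carrier G \<and> H \<noteq> {\<one>\<^bsub>G\<^esub>}}"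

definition intersection_graph :: "('a, 'b) monoid_scheme \<Rightarrow> 'a set ugraph" where
  "intersection_graph G =
     (proper_nontrivial_subgroups G,
      {{H, K} | H K. H \<in> proper_nontrivial_subgroups G \<and> K \<in> proper_nontrivial_subgroups G \<and>
                     H \<noteq> K \<and> H \<inter> K \<noteq> {\<one>\<^bsub>G\<^esub>}})"

end

theory Submission
  imports Defs
begin

text \<open>The subgroups of the dihedral group of order \<open>2n\<close> are \<open>\<langle>r\<^sup>d\<rangle>\<close> and \<open>\<langle>r\<^sup>d, r\<^sup>i s\<rangle>\<close>, where \<open>d\<close> divides
  \<open>n\<close> and \<open>0 \<le> i < d\<close>. For \<open>n = p\<^sup>2\<close> the \<open>p + 2\<close> proper ones with \<open>d \<in> {1, p}\<close> all contain \<open>r\<^sup>p\<close>, so they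
  form a clique. The others are the \<open>p\<^sup>2\<close> subgroups \<open>\<langle>r\<^sup>i s\<rangle>\<close> of order two, each of which is
  adjacent only to \<open>\<langle>r\<^sup>p, r\<^sup>i s\<rangle>\<close>. The number of edges is therefore \<open>(p + 2) (p + 1) / 2 + p\<^sup>2\<close>.\<close>

section \<open>Subgroups of the integers\<close>

text \<open>Division with remainder: modulo the least positive element of \<open>S\<close>, the
  remainder of any element lies in \<open>S\<close> again, so minimality forces it to be 0. The set
  of exponents of the rotations in a subgroup has this form.\<close>

lemma int_subgroup_principal:
  fixes S :: "int set"
  assumes "n > 0" "n \<in> S" and diff: "\<And>a b. a \<in> S \<Longrightarrow> b \<in> S \<Longrightarrow> a - b \<in> S"
  obtains d where "d > 0" "S = {k. d dvd k}"
proof -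
  define d where "d = int (LEAST m. m > 0 \<and> int m \<in> S)"
  have "\<exists>m. m > 0 \<and> int m \<in> S"
    using assms(1,2) by (intro exI[of _ "nat n"]) auto
  from LeastI_ex[OF this] have d: "d > 0" "d \<in> S"
    by (simp_all add: d_def)
  have least: "d \<le> k" if "k > 0" "k \<in> S" for k
    using Least_le[of "\<lambda>m. m > 0 \<and> int m \<in> S" "nat k"] that by (simp add: d_def le_nat_iff)
  have zero: "0 \<in> S"
    using diff[OF d(2) d(2)] by simp
  have mult: "d * q \<in> S" for q
  proof (induction q rule: int_induct[where k = 0])
    case base
    then show ?case using zero by simp
  next
    case (step1 i)
    \<comment> \<open>Only closure under differences is given, so adding \<open>d\<close> is written
      as subtracting \<open>0 - d\<close>.\<close>
    have "d * i - (0 - d) \<in> S"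
      by (intro diff zero d step1)
    then show ?case by (simp add: algebra_simps)
  next
    case (step2 i)
    have "d * i - d \<in> S"
      by (intro diff d step2)
    then show ?case by (simp add: algebra_simps)
  qed
  have "d dvd k" if "k \<in> S" for k
  proof (rule ccontr)
    assume "\<not> d dvd k"
    then have "k mod d > 0"
      using d(1) by (simp add: dvd_eq_mod_eq_0 order_less_le)
    moreover have "k mod d \<in> S"
      using diff[OF that mult[of "k div d"]] by (simp add: minus_mult_div_eq_mod)
    ultimately show False
      using least[of "k mod d"] pos_mod_bound[OF d(1), of k] by simp
  qed
  then have "S = {k. d dvd k}"
    using mult by (auto elim!: dvdE)
  with d(1) show ?thesis by (rule that)
qed

section \<open>Dihedral groups in integer coordinates\<close>

text \<open>Here \<open>rot i\<close> and \<open>ref i\<close> stand for \<open>r\<^sup>i\<close> and \<open>r\<^sup>i s\<close>.\<close>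

locale dihedral = group +
  fixes n :: int and rot ref :: "int \<Rightarrow> 'a"
  assumes n_pos: "n > 0"
    and carrier_eq: "carrier G = range rot \<union> range ref"
    and rot_rot: "rot i \<otimes> rot j = rot (i + j)"
    and rot_ref: "rot i \<otimes> ref j = ref (i + j)"
    and ref_rot: "ref i \<otimes> rot j = ref (i - j)"
    and ref_ref: "ref i \<otimes> ref j = rot (i - j)"
    and rot_eq_iff: "rot i = rot j \<longleftrightarrow> n dvd i - j"
    and ref_eq_iff: "ref i = ref j \<longleftrightarrow> n dvd i - j"
    and rot_neq_ref: "rot i \<noteq> ref j"
begin

lemma rot_carrier: "rot i \<in> carrier G" and ref_carrier: "ref i \<in> carrier G"
  by (auto simp: carrier_eq)

lemma one_eq: "\<one> = rot 0"
  using rot_rot[of 0 0] r_cancel_one[of "rot 0" "rot 0"] rot_carrier by simp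

lemma inv_rot: "inv (rot i) = rot (- i)"
  by (rule inv_equality) (simp_all add: rot_rot one_eq rot_carrier)

lemma inv_ref: "inv (ref i) = ref i"
  by (rule inv_equality) (simp_all add: ref_ref one_eq ref_carrier)

section \<open>Classification of the subgroups\<close>

text \<open>The subgroup generated by \<open>r^d\<close>. Taking all integer multiples of
  \<open>d\<close> as indices avoids reductions modulo \<open>n\<close>.\<close>

definition cyc :: "int \<Rightarrow> 'a set" where
  "cyc d = rot ` {k. d dvd k}"

text \<open>For \<open>d\<close> dividing \<open>n\<close>, the subgroup generated by
  \<open>r^d\<close> and \<open>r^i s\<close>; its reflections form one residue class of indices
  modulo \<open>d\<close>.\<close>

definition dih :: "int \<Rightarrow> int \<Rightarrow> 'a set" where
  "dih d i = cyc d \<union> ref ` {k. d dvd k - i}"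

text \<open>An element fixes its index only modulo \<open>n\<close>; as \<open>d\<close> divides
  \<open>n\<close>, divisibility of the index by \<open>d\<close> is still well defined.\<close>

lemma rot_in_cyc: "d dvd n \<Longrightarrow> rot k \<in> cyc d \<longleftrightarrow> d dvd k"
  by (auto simp: cyc_def rot_eq_iff) (metis dvd_trans dvd_diff_commute dvd_diffD zdvd_zdiffD)

lemma ref_in_cyc: "ref k \<notin> cyc d"
  using rot_neq_ref[symmetric] by (auto simp: cyc_def)

lemma rot_in_dih: "d dvd n \<Longrightarrow> rot k \<in> dih d i \<longleftrightarrow> d dvd k"
  using rot_neq_ref by (auto simp: dih_def rot_in_cyc)

lemma ref_in_dih: "d dvd n \<Longrightarrow> ref k \<in> dih d i \<longleftrightarrow> d dvd k - i"
proof -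
  assume d: "d dvd n"
  have "d dvd k - i" if "ref k = ref l" "d dvd l - i" for l
  proof -
    have "d dvd (k - l) + (l - i)"
      using that d by (intro dvd_add) (auto simp: ref_eq_iff intro: dvd_trans)
    then show ?thesis by simp
  qed
  then show ?thesis
    by (auto simp: dih_def ref_in_cyc)
qed

lemmas mem_simps = rot_in_cyc ref_in_cyc rot_in_dih ref_in_dih

lemma subgroup_cyc: "subgroup (cyc d) G"
  by (rule subgroupI) (auto simp: cyc_def rot_carrier inv_rot rot_rot)

lemma subgroup_dih:
  assumes "d dvd n"
  shows "subgroup (dih d i) G"
proof (rule subgroupI)
  have mem: "(\<exists>k. x = rot k \<and> d dvd k) \<or> (\<exists>k. x = ref k \<and> d dvd k - i)" if "x \<in> dih d i" for x
    using that by (auto simp: dih_def cyc_def)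
  show "dih d i \<subseteq> carrier G"
    using mem by (fastforce simp: rot_carrier ref_carrier)
  show "dih d i \<noteq> {}"
    using rot_in_dih[OF assms, of 0 i] by auto
  show "inv x \<in> dih d i" if "x \<in> dih d i" for x
    using mem[OF that] by (auto simp: inv_rot inv_ref mem_simps assms)
  \<comment> \<open>The next three facts are the index conditions for the products
    reflection-reflection, rotation-reflection and reflection-rotation.\<close>
  have diff: "d dvd k - l" if "d dvd k - i" "d dvd l - i" for k l
    using dvd_diff[OF that] by simp
  have plus: "d dvd k + l - i" if "d dvd k" "d dvd l - i" for k l
    using dvd_add[OF that] by (simp add: algebra_simps)
  have minus: "d dvd l - k - i" if "d dvd k" "d dvd l - i" for k l
    using dvd_diff[OF that(2,1)] by (simp add: algebra_simps)
  show "x \<otimes> y \<in> dih d i" if "x \<in> dih d i" "y \<in> dih d i" for x y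
    using mem[OF that(1)] mem[OF that(2)]
    by (auto simp: rot_rot rot_ref ref_rot ref_ref mem_simps assms diff plus minus)
qed

text \<open>Reduces equality of subgroups to divisibility conditions on indices.\<close>

lemma eq_if_same_rot_ref:
  assumes "H \<subseteq> carrier G" "K \<subseteq> carrier G"
    and "\<And>k. rot k \<in> H \<longleftrightarrow> rot k \<in> K" "\<And>k. ref k \<in> H \<longleftrightarrow> ref k \<in> K"
  shows "H = K"
  using assms unfolding carrier_eq by blast

lemma dih_mod:
  assumes "d dvd n"
  shows "dih d (i mod d) = dih d i"
proof (rule eq_if_same_rot_ref)
  fix k
  have "d dvd k - i mod d \<longleftrightarrow> d dvd k - i"
    by (metis mod_eq_dvd_iff mod_mod_trivial)
  then show "ref k \<in> dih d (i mod d) \<longleftrightarrow> ref k \<in> dih d i"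
    by (simp add: mem_simps assms)
qed (auto simp: mem_simps assms subgroup.subset subgroup_dih)

text \<open>The rotation indices of \<open>H\<close> form a subgroup of the integers, which gives
  \<open>d\<close>. If \<open>H\<close> contains a reflection, its reflections form a single coset
  of its rotations.\<close>

lemma subgroup_cases:
  assumes H: "subgroup H G"
  obtains d where "d > 0" "d dvd n" "H = cyc d"
  | d i where "d > 0" "d dvd n" "i \<in> {0..<d}" "H = dih d i"
proof -
  note mult = subgroup.m_closed[OF H] and inv = subgroup.m_inv_closed[OF H]
  have sub: "H \<subseteq> carrier G"
    using H by (rule subgroup.subset)
  have "rot n = \<one>"
    by (simp add: one_eq rot_eq_iff)
  \<comment> \<open>This membership provides both the positive element needed for
    \<open>int_subgroup_principal\<close> and the divisibility \<open>d dvd n\<close>.\<close>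
  then have "n \<in> {k. rot k \<in> H}"
    using subgroup.one_closed[OF H] by simp
  moreover have "a - b \<in> {k. rot k \<in> H}" if "a \<in> {k. rot k \<in> H}" "b \<in> {k. rot k \<in> H}" for a b
    using mult[of "rot a" "inv (rot b)"] inv[of "rot b"] that by (simp add: inv_rot rot_rot)
  ultimately obtain d where d: "d > 0" and S: "{k. rot k \<in> H} = {k. d dvd k}"
    using int_subgroup_principal[OF n_pos] by metis
  have rot_H: "rot k \<in> H \<longleftrightarrow> d dvd k" for k
    using S by blast
  have dn: "d dvd n"
    using S \<open>n \<in> _\<close> by blast
  show ?thesis
  proof (cases "\<exists>i. ref i \<in> H")
    case True
    then obtain i where i: "ref i \<in> H" by blast
    \<comment> \<open>Right multiplication by \<open>ref i\<close> exchanges \<open>ref k\<close>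
      and \<open>rot (k - i)\<close>.\<close>
    have "ref k \<in> H \<longleftrightarrow> d dvd k - i" for k
      using mult[of "ref k" "ref i"] mult[of "rot (k - i)" "ref i"] i
      by (auto simp: rot_H ref_ref rot_ref)
    then have "H = dih d i"
      by (intro eq_if_same_rot_ref sub subgroup.subset[OF subgroup_dih]) (simp_all add: rot_H mem_simps dn)
    then show ?thesis
      using d dn by (intro that(2)[of d "i mod d"]) (simp_all add: dih_mod)
  next
    case False
    then have "H = cyc d"
      by (intro eq_if_same_rot_ref sub subgroup.subset[OF subgroup_cyc]) (simp_all add: rot_H mem_simps dn)
    then show ?thesis
      using d dn that(1) by blast
  qed
qed

lemma cyc_neq_dih: "d' dvd n \<Longrightarrow> cyc d \<noteq> dih d' i"
  using ref_in_dih[of d' i i] ref_in_cyc[of i d] by auto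

lemma cyc_eq_iff: "d > 0 \<Longrightarrow> d' > 0 \<Longrightarrow> d dvd n \<Longrightarrow> d' dvd n \<Longrightarrow> cyc d = cyc d' \<longleftrightarrow> d = d'"
  by (metis rot_in_cyc dvd_refl zdvd_antisym_nonneg less_imp_le)

text \<open>The rotations recover \<open>d\<close>, the reflections recover \<open>i\<close> modulo
  \<open>d\<close>, and the range of \<open>i\<close> makes the residue unique.\<close>

lemma dih_eq_iff:
  assumes "d > 0" "d' > 0" "d dvd n" "d' dvd n" "i \<in> {0..<d}" "i' \<in> {0..<d'}"
  shows "dih d i = dih d' i' \<longleftrightarrow> d = d' \<and> i = i'"
proof
  assume eq: "dih d i = dih d' i'"
  then have "d = d'"
    using assms by (metis rot_in_dih dvd_refl zdvd_antisym_nonneg less_imp_le)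
  moreover have "d' dvd i - i'"
    using eq ref_in_dih[of d i i] ref_in_dih[of d' i i'] assms by simp
  ultimately show "d = d' \<and> i = i'"
    using assms by (metis atLeastLessThan_iff mod_eq_dvd_iff mod_pos_pos_trivial)
qed simp

text \<open>With the two excluded subgroups in standard form, properness and nontriviality become
  comparisons of parameters.\<close>

lemma trivial_eq: "{\<one>} = cyc n" and carrier_eq_dih: "carrier G = dih 1 0"
  by (auto simp: one_eq cyc_def dih_def carrier_eq rot_eq_iff intro!: image_eqI[of _ _ 0])

section \<open>The vertices for \<open>n = p^2\<close>\<close>

lemma proper_nontrivial_subgroups_prime_square:
  assumes p: "Factorial_Ring.prime p" and n: "n = p ^ 2"
  shows "proper_nontrivial_subgroups G =
    {cyc 1, cyc p} \<union> dih p ` {0..<p} \<union> dih n ` {0..<n}" (is "_ = ?S")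
proof
  have p1: "p > 1" "n > 1" "p dvd n" "p \<noteq> n"
    using prime_gt_1_int[OF p] by (auto simp: n power2_eq_square less_1_mult)
  show "proper_nontrivial_subgroups G \<subseteq> ?S"
  proof
    fix H
    assume "H \<in> proper_nontrivial_subgroups G"
    then have H: "subgroup H G" "H \<noteq> dih 1 0" "H \<noteq> cyc n"
      by (auto simp: proper_nontrivial_subgroups_def simp flip: trivial_eq carrier_eq_dih)
    have div: "d = 1 \<or> d = p \<or> d = n" if "d > 0" "d dvd n" for d
    proof -
      \<comment> \<open>The divisor is known as a power of \<open>p\<close> only up to sign;
        positivity of \<open>d\<close> settles the sign.\<close>
      obtain k where k: "k \<le> 2" "normalize d = normalize (p ^ k)"
        using \<open>d dvd n\<close> divides_primepow_weak[OF p, of d 2] by (auto simp: n)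
      then have "d = p ^ k"
        using that(1) p1(1) by simp
      moreover have "k = 0 \<or> k = 1 \<or> k = 2"
        using k(1) by linarith
      ultimately show ?thesis by (auto simp: n)
    qed
    show "H \<in> ?S"
      using H(1)
    proof (cases rule: subgroup_cases)
      case (1 d)
      then show ?thesis using div[of d] H(3) by auto
    next
      case (2 d i)
      \<comment> \<open>For \<open>d = 1\<close> the range leaves only \<open>i = 0\<close>, which
        is the whole group.\<close>
      have "d \<noteq> 1"
      proof
        assume "d = 1"
        moreover from this have "i = 0" using 2(3) by simp
        ultimately show False using 2(4) H(2) by simp
      qed
      then show ?thesis using 2 div[of d] by auto
    qed
  qed
  have mem: "H \<in> proper_nontrivial_subgroups G \<longleftrightarrow> subgroup H G \<and> H \<noteq> dih 1 0 \<and> H \<noteq> cyc n" for H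
    by (simp only: proper_nontrivial_subgroups_def trivial_eq carrier_eq_dih mem_Collect_eq)
  have "cyc d \<in> proper_nontrivial_subgroups G" if "d \<in> {1, p}" for d
    using that p1 n_pos unfolding mem by (auto simp: subgroup_cyc cyc_neq_dih cyc_eq_iff)
  moreover have "dih d i \<in> proper_nontrivial_subgroups G" if "d \<in> {p, n}" "i \<in> {0..<d}" for d i
  proof -
    have "d > 1" "d dvd n" using that p1 n_pos by auto
    then show ?thesis
      using that(2) unfolding mem by (simp add: subgroup_dih cyc_neq_dih[symmetric] dih_eq_iff)
  qed
  ultimately show "?S \<subseteq> proper_nontrivial_subgroups G"
    by auto
qed

section \<open>Counting the edges\<close>

lemma card_edges_prime_square:
  assumes p: "Factorial_Ring.prime p" and n: "n = p ^ 2"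
  shows "card (ugraph_edges (intersection_graph G)) = (nat p + 2 choose 2) + nat n"
proof -
  \<comment> \<open>\<open>C\<close> holds the vertices containing \<open>rot p\<close>, and
    \<open>T\<close> the subgroups of order two generated by a reflection.\<close>
  define C where "C = {cyc 1, cyc p} \<union> dih p ` {0..<p}"
  define T where "T = dih n ` {0..<n}"
  have p1: "p > 1" "p dvd n" "p \<noteq> n" "\<not> n dvd p"
    using prime_gt_1_int[OF p] by (auto simp: n power2_eq_square dest: zdvd_imp_le)
  have rot_p: "rot p \<noteq> \<one>"
    using p1(4) by (simp add: one_eq rot_eq_iff)
  have C_adj: "H \<inter> K \<noteq> {\<one>}" if "H \<in> C" "K \<in> C" for H K
  proof -
    have "rot p \<in> H \<inter> K"
      using that p1 by (auto simp: C_def mem_simps)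
    then show ?thesis using rot_p by blast
  qed
  \<comment> \<open>A rotation is the identity exactly when \<open>n\<close> divides its index, and
    a reflection never is.\<close>
  have inter_iff: "H \<inter> K = {\<one>} \<longleftrightarrow> (\<forall>k. rot k \<in> H \<inter> K \<longrightarrow> n dvd k) \<and> (\<forall>k. ref k \<notin> H \<inter> K)"
    if "subgroup H G" "subgroup K G" for H K
  proof -
    have "rot 0 \<in> H \<inter> K" "H \<inter> K \<subseteq> range rot \<union> range ref"
      using subgroup.one_closed[OF that(1)] subgroup.one_closed[OF that(2)]
        subgroup.subset[OF that(1)] by (auto simp: one_eq carrier_eq)
    then have "H \<inter> K = {\<one>} \<longleftrightarrow>
        (\<forall>k. rot k \<in> H \<inter> K \<longrightarrow> rot k = rot 0) \<and> (\<forall>k. ref k \<in> H \<inter> K \<longrightarrow> ref k = rot 0)"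
      unfolding one_eq by blast
    then show ?thesis
      by (simp add: rot_eq_iff rot_neq_ref[symmetric])
  qed
  \<comment> \<open>The only non-identity element of \<open>dih n i\<close> is \<open>ref i\<close>,
    so a nontrivial intersection means \<open>ref i \<in> K\<close>. The disjunct
    \<open>K = dih n i\<close> is the vertex itself and yields no edge.\<close>
  have T_adj: "dih n i \<inter> K \<noteq> {\<one>} \<longleftrightarrow> K = dih n i \<or> K = dih p (i mod p)"
    if i: "i \<in> {0..<n}" and K: "K \<in> C \<union> T" for i K
  proof -
    have subgroup_K: "subgroup K G"
      using K p1 by (auto simp: C_def T_def subgroup_cyc subgroup_dih)
    have "dih n i \<inter> K = {\<one>} \<longleftrightarrow> (\<forall>k. n dvd k - i \<longrightarrow> ref k \<notin> K)"
      using inter_iff[OF subgroup_dih[OF dvd_refl, of i] subgroup_K] by (auto simp: mem_simps)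
    also have "\<dots> \<longleftrightarrow> ref i \<notin> K"
      using ref_eq_iff by (metis diff_self dvd_0_right)
    finally have adj: "dih n i \<inter> K \<noteq> {\<one>} \<longleftrightarrow> ref i \<in> K" by blast
    \<comment> \<open>For fixed \<open>d\<close>, the groups \<open>dih d j\<close> partition the
      reflections by residue modulo \<open>d\<close>, so \<open>ref i\<close> lies in exactly one of
      them.\<close>
    have dihK: "ref i \<in> dih d j \<longleftrightarrow> dih d j = dih d (i mod d)"
      if "d > 0" "d dvd n" "j \<in> {0..<d}" for d j
    proof -
      have "ref i \<in> dih d j \<longleftrightarrow> i mod d = j mod d"
        unfolding ref_in_dih[OF that(2)] by (rule mod_eq_dvd_iff[symmetric])
      also have "\<dots> \<longleftrightarrow> dih d j = dih d (i mod d)"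
        using that by (subst dih_eq_iff) auto
      finally show ?thesis .
    qed
    consider "K = cyc 1" | "K = cyc p" | j where "j \<in> {0..<p}" "K = dih p j"
      | j where "j \<in> {0..<n}" "K = dih n j"
      using K by (auto simp: C_def T_def)
    then show ?thesis
    proof cases
      case 3
      moreover have "K \<noteq> dih n i"
        using 3 i p1 n_pos by (simp add: dih_eq_iff)
      ultimately show ?thesis
        unfolding adj using dihK[of p j] p1 by simp
    next
      case 4
      moreover have "K \<noteq> dih p (i mod p)"
        using 4 p1 n_pos by (simp add: dih_eq_iff)
      ultimately show ?thesis
        unfolding adj using dihK[of n j] n_pos i by simp
    qed (unfold adj, use p1 in \<open>simp_all add: ref_in_cyc cyc_neq_dih\<close>)
  qed
  \<comment> \<open>\<open>f i\<close> is the unique edge at the vertex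
    \<open>dih n i\<close>.\<close>
  define f where "f i = {dih n i, dih p (i mod p)}" for i
  have disj: "dih n i \<notin> C" "dih n i \<noteq> dih p (j mod p)" if "i \<in> {0..<n}" for i j
    using that p1 n_pos by (auto simp: C_def cyc_neq_dih[symmetric] dih_eq_iff)
  have in_C: "dih p (i mod p) \<in> C" for i
    using p1 by (auto simp: C_def)
  have "ugraph_edges (intersection_graph G) = {X. X \<subseteq> C \<and> card X = 2} \<union> f ` {0..<n}" (is "?E = ?F \<union> _")
  proof -
    have E: "?E = {{H, K} | H K. H \<in> C \<union> T \<and> K \<in> C \<union> T \<and> H \<noteq> K \<and> H \<inter> K \<noteq> {\<one>}}"
      by (simp add: ugraph_edges_def intersection_graph_def C_def T_def
          proper_nontrivial_subgroups_prime_square[OF p n])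
    have 1: "{dih n i, K} \<in> f ` {0..<n}"
      if "i \<in> {0..<n}" "K \<in> C \<union> T" "dih n i \<noteq> K" "dih n i \<inter> K \<noteq> {\<one>}" for i K
      using that T_adj[of i K] by (auto simp: f_def)
    have 2: "{H, K} \<in> ?F \<union> f ` {0..<n}"
      if HK: "H \<in> C \<union> T" "K \<in> C \<union> T" "H \<noteq> K" "H \<inter> K \<noteq> {\<one>}" for H K
    proof -
      \<comment> \<open>Either both ends lie in the clique or one end has order two; the last two
        cases differ only by swapping the ends.\<close>
      consider "H \<in> C" "K \<in> C" | i where "i \<in> {0..<n}" "H = dih n i"
        | i where "i \<in> {0..<n}" "K = dih n i"
        using HK(1,2) unfolding T_def by blast
      then show ?thesis
      proof cases
        case 1
        then show ?thesis using that(3) by simp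
      next
        case 2
        then show ?thesis using 1[of i K] that by simp
      next
        case 3
        then show ?thesis using 1[of i H] that by (simp add: insert_commute Int_commute)
      qed
    qed
    have EI: "{H, K} \<in> ?E" if "H \<in> C \<union> T" "K \<in> C \<union> T" "H \<noteq> K" "H \<inter> K \<noteq> {\<one>}" for H K
      unfolding E mem_Collect_eq by (rule exI[where x = H], rule exI[where x = K]) (simp only: that simp_thms)
    have 3: "f i \<in> ?E" if i: "i \<in> {0..<n}" for i
      unfolding f_def
    proof (rule EI)
      show "dih n i \<inter> dih p (i mod p) \<noteq> {\<one>}"
        using T_adj[OF i, of "dih p (i mod p)"] in_C by simp
      show "dih n i \<noteq> dih p (i mod p)"
        by (rule disj(2)[OF i])
    qed (use i in_C in \<open>simp_all add: T_def\<close>)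
    have 4: "X \<in> ?E" if X: "X \<in> ?F" for X
    proof -
      obtain H K where HK: "X = {H, K}" "H \<noteq> K"
        using X by (auto simp: card_2_iff)
      moreover have "H \<in> C" "K \<in> C"
        using X HK by auto
      ultimately show ?thesis
        using EI[of H K] C_adj[of H K] by simp
    qed
    show ?thesis
    proof (intro equalityI subsetI)
      fix X
      assume "X \<in> ?E"
      then obtain H K where "X = {H, K}" "H \<in> C \<union> T" "K \<in> C \<union> T" "H \<noteq> K" "H \<inter> K \<noteq> {\<one>}"
        unfolding E mem_Collect_eq by (elim exE conjE)
      then show "X \<in> ?F \<union> f ` {0..<n}"
        using 2 by (simp only:)
    qed (use 3 4 in \<open>elim UnE imageE; simp only:\<close>)
  qed
  moreover have "?F \<inter> f ` {0..<n} = {}"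
    using disj(1) by (auto simp: f_def)
  \<comment> \<open>Equal pairs could match crosswise, but \<open>dih n i\<close> is never some
    \<open>dih p (j mod p)\<close>; hence the ends of order two agree.\<close>
  moreover have "inj_on f {0..<n}"
    using disj(2) dih_eq_iff[OF n_pos n_pos] by (intro inj_onI) (auto simp: f_def doubleton_eq_iff)
  moreover have "finite C"
    by (simp add: C_def)
  moreover have "card C = nat p + 2"
  proof -
    have "card (dih p ` {0..<p}) = nat p"
      using p1 by (subst card_image) (auto simp: inj_on_def dih_eq_iff)
    moreover have "cyc 1 \<noteq> cyc p" "{cyc 1, cyc p} \<inter> dih p ` {0..<p} = {}"
      using p1 by (auto simp: cyc_eq_iff cyc_neq_dih)
    ultimately show ?thesis
      unfolding C_def by (subst card_Un_disjoint) auto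
  qed
  ultimately show ?thesis
    by (simp add: card_Un_disjoint card_image n_subsets)
qed

end

section \<open>Coordinates on the presented dihedral group\<close>

text \<open>The relations yield the product rules and reduce every word to a rotation or a
  reflection. That these are distinct cannot be read off the relations and comes from the order of
  the group.\<close>

lemma dihedral_dihedral_group:
  assumes "n \<ge> 3"
  obtains rot ref where "dihedral (dihedral_group n) (int n) rot ref"
proof -
  let ?R = "dihedral_relations n" and ?D = "dihedral_group n"
  let ?c = "word_class (dihedral_relations n)"
  interpret group ?D
    unfolding dihedral_group_def by (rule group_presented_group)
  define r where "r = ?c [(Rot, True)]"
  define s where "s = ?c [(Ref, True)]"
  have car: "carrier ?D = range ?c"
    by (simp add: dihedral_group_def presented_group_def)
  have one: "\<one>\<^bsub>?D\<^esub> = ?c []"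
    by (simp add: dihedral_group_def presented_group_def)
  have mult: "?c u \<otimes>\<^bsub>?D\<^esub> ?c v = ?c (u @ v)" for u v
    by (simp add: dihedral_group_def word_class_mult)
  have rel: "?c u = ?c v" if "(u, v) \<in> ?R" for u v
    using that by (simp add: word_class_eq_iff word_eq.relation)
  have rc [simp]: "r \<in> carrier ?D" and sc [simp]: "s \<in> carrier ?D"
    by (auto simp: r_def s_def car)
  have pow: "?c [a] [^]\<^bsub>?D\<^esub> (i::nat) = ?c (replicate i a)" for a i
    by (induction i) (simp_all add: one mult replicate_append_same)
  have rn: "r [^]\<^bsub>?D\<^esub> int n = \<one>\<^bsub>?D\<^esub>"
    unfolding int_pow_int r_def pow one by (rule rel) (simp add: dihedral_relations_def)
  have ss: "s \<otimes>\<^bsub>?D\<^esub> s = \<one>\<^bsub>?D\<^esub>"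
    unfolding s_def mult one by (rule rel) (simp add: dihedral_relations_def numeral_2_eq_2)
  have letter_False: "?c [(x, False)] = inv\<^bsub>?D\<^esub> ?c [(x, True)]" for x
    using word_eq.cancel[of ?R x False]
    by (intro inv_equality[symmetric]) (auto simp: car mult one word_class_eq_iff)
  have srs: "s \<otimes>\<^bsub>?D\<^esub> r \<otimes>\<^bsub>?D\<^esub> s = inv\<^bsub>?D\<^esub> r"
    unfolding r_def s_def mult letter_False[symmetric]
    by (rule rel) (simp add: dihedral_relations_def)
  define rot where "rot i = r [^]\<^bsub>?D\<^esub> i" for i :: int
  define ref where "ref i = rot i \<otimes>\<^bsub>?D\<^esub> s" for i
  have rotc [simp]: "rot i \<in> carrier ?D" and refc [simp]: "ref i \<in> carrier ?D" for i
    by (simp_all add: rot_def ref_def)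
  have rot_rot: "rot i \<otimes>\<^bsub>?D\<^esub> rot j = rot (i + j)" for i j
    by (simp add: rot_def int_pow_mult)
  have rot_0: "rot 0 = \<one>\<^bsub>?D\<^esub>" and rot_1: "rot 1 = r" and rot_m1: "rot (- 1) = inv\<^bsub>?D\<^esub> r"
    by (simp_all add: rot_def int_pow_neg)
  \<comment> \<open>Multiply \<open>srs\<close> on the right by \<open>s\<close> and cancel
    \<open>s\<close> squared.\<close>
  have s_r: "s \<otimes>\<^bsub>?D\<^esub> r = rot (- 1) \<otimes>\<^bsub>?D\<^esub> s"
    using srs ss by (metis rot_m1 m_assoc m_closed r_one rc sc)
  have s_rot_nat: "s \<otimes>\<^bsub>?D\<^esub> rot (int i) = rot (- int i) \<otimes>\<^bsub>?D\<^esub> s" for i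
  proof (induction i)
    case (Suc i)
    have "s \<otimes>\<^bsub>?D\<^esub> rot (int (Suc i)) = (s \<otimes>\<^bsub>?D\<^esub> rot (int i)) \<otimes>\<^bsub>?D\<^esub> r"
      using rot_rot[of "int i" 1] by (simp add: m_assoc rot_1 add.commute)
    also have "\<dots> = rot (- int i) \<otimes>\<^bsub>?D\<^esub> (s \<otimes>\<^bsub>?D\<^esub> r)"
      by (simp add: Suc.IH m_assoc)
    also have "\<dots> = rot (- int (Suc i)) \<otimes>\<^bsub>?D\<^esub> s"
      using rot_rot[of "- int i" "- 1"] by (simp add: s_r add.commute flip: m_assoc)
    finally show ?case .
  qed (simp add: rot_0)
  \<comment> \<open>For a nonpositive index, multiply the rule for its negative by \<open>s\<close>
    on both sides and cancel \<open>s\<close> squared.\<close>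
  have s_rot: "s \<otimes>\<^bsub>?D\<^esub> rot i = rot (- i) \<otimes>\<^bsub>?D\<^esub> s" for i
  proof (cases i rule: int_cases2)
    case (nonpos m)
    have "s \<otimes>\<^bsub>?D\<^esub> (s \<otimes>\<^bsub>?D\<^esub> rot (int m)) \<otimes>\<^bsub>?D\<^esub> s = s \<otimes>\<^bsub>?D\<^esub> (rot (- int m) \<otimes>\<^bsub>?D\<^esub> s) \<otimes>\<^bsub>?D\<^esub> s"
      by (simp add: s_rot_nat)
    then have "(s \<otimes>\<^bsub>?D\<^esub> s) \<otimes>\<^bsub>?D\<^esub> rot (int m) \<otimes>\<^bsub>?D\<^esub> s = s \<otimes>\<^bsub>?D\<^esub> rot (- int m) \<otimes>\<^bsub>?D\<^esub> (s \<otimes>\<^bsub>?D\<^esub> s)"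
      by (simp add: m_assoc)
    then show ?thesis
      by (simp add: ss nonpos)
  qed (simp add: s_rot_nat)
  have rot_ref: "rot i \<otimes>\<^bsub>?D\<^esub> ref j = ref (i + j)" for i j
    by (simp add: ref_def rot_rot flip: m_assoc)
  have ref_rot: "ref i \<otimes>\<^bsub>?D\<^esub> rot j = ref (i - j)" for i j
    using rot_rot[of i "- j"] by (simp add: ref_def m_assoc s_rot) (simp flip: m_assoc)
  have ref_ref: "ref i \<otimes>\<^bsub>?D\<^esub> ref j = rot (i - j)" for i j
  proof -
    have "ref i \<otimes>\<^bsub>?D\<^esub> ref j = (ref i \<otimes>\<^bsub>?D\<^esub> rot j) \<otimes>\<^bsub>?D\<^esub> s"
      by (simp add: ref_def[of j] m_assoc)
    also have "\<dots> = rot (i - j)"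
      unfolding ref_rot by (simp add: ref_def m_assoc ss)
    finally show ?thesis .
  qed
  have rot_mod: "rot (i mod int n) = rot i" for i
  proof -
    have "rot i = rot (int n * (i div int n) + i mod int n)" by simp
    also have "\<dots> = (r [^]\<^bsub>?D\<^esub> int n) [^]\<^bsub>?D\<^esub> (i div int n) \<otimes>\<^bsub>?D\<^esub> rot (i mod int n)"
      unfolding rot_rot[symmetric] by (simp only: rot_def int_pow_pow rc)
    finally show ?thesis by (simp add: rn)
  qed
  have ref_0: "ref 0 = s"
    by (simp add: ref_def rot_0)
  \<comment> \<open>Each letter is \<open>rot 1\<close>, \<open>rot (- 1)\<close> or
    \<open>ref 0\<close>, and the product rules keep the set of rotations and reflections
    closed.\<close>
  have word: "?c w \<in> range rot \<union> range ref" for w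
  proof (induction w)
    case Nil
    then show ?case using rot_0 one by (metis UnI1 rangeI)
  next
    case (Cons a w)
    obtain x b where a: "a = (x, b)" by force
    have "?c [a] \<in> range rot \<union> range ref"
    proof (cases x)
      case Rot
      then have "?c [a] = rot 1 \<or> ?c [a] = rot (- 1)"
        by (cases b) (simp_all add: a letter_False rot_1 rot_m1 flip: r_def)
      then show ?thesis by auto
    next
      case Ref
      then have "?c [a] = ref 0"
        using inv_equality[OF ss] by (cases b) (simp_all add: a letter_False ref_0 flip: s_def)
      then show ?thesis by auto
    qed
    moreover have "?c (a # w) = ?c [a] \<otimes>\<^bsub>?D\<^esub> ?c w"
      by (simp add: mult)
    ultimately show ?case
      using Cons.IH by (auto simp: rot_rot rot_ref ref_rot ref_ref)
  qed
  have carrier_eq: "carrier ?D = range rot \<union> range ref"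
    using word by (auto simp: car[symmetric]) (auto simp: car)
  \<comment> \<open>The Boolean marks reflections, so one period of indices gives a domain with
    \<open>2 * n\<close> elements, matching the order.\<close>
  define f where "f = (\<lambda>(i, b). if b then ref i else rot i)"
  have f_mod: "f (i mod int n, b) = f (i, b)" for i b
    by (simp add: f_def ref_def rot_mod)
  have "f ` ({0..<int n} \<times> UNIV) = carrier ?D"
  proof -
    have "f (i, b) \<in> f ` ({0..<int n} \<times> UNIV)" for i b
      using assms f_mod[of i b] by (intro image_eqI[of _ _ "(i mod int n, b)"]) auto
    from this[of _ True] this[of _ False] show ?thesis
      by (auto simp: carrier_eq f_def split: if_splits)
  qed
  text \<open>The order formula turns the surjection \<open>f\<close> between sets of equal size into a bijection.\<close>
  then have inj: "inj_on f ({0..<int n} \<times> UNIV)"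
    using order_dihedral_group[OF assms] by (intro eq_card_imp_inj_on) (simp_all add: order_def)
  \<comment> \<open>Injectivity on one period, extended to all integer indices by periodicity,
    supplies the three remaining conditions of the locale at once.\<close>
  have f_eq: "f (i, b) = f (j, b') \<longleftrightarrow> int n dvd i - j \<and> b = b'" for i j b b'
  proof -
    have "f (i, b) = f (j, b') \<longleftrightarrow> f (i mod int n, b) = f (j mod int n, b')"
      by (simp only: f_mod)
    also have "\<dots> \<longleftrightarrow> i mod int n = j mod int n \<and> b = b'"
      using assms by (subst inj_on_eq_iff[OF inj]) auto
    finally show ?thesis by (simp add: mod_eq_dvd_iff)
  qed
  have "dihedral ?D (int n) rot ref"
  proof unfold_locales
    show "int n > 0" using assms by simp
    show "carrier ?D = range rot \<union> range ref" by (rule carrier_eq)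
    show "rot i = rot j \<longleftrightarrow> int n dvd i - j" for i j
      using f_eq[of i False j False] by (simp add: f_def)
    show "ref i = ref j \<longleftrightarrow> int n dvd i - j" for i j
      using f_eq[of i True j True] by (simp add: f_def)
    show "rot i \<noteq> ref j" for i j
      using f_eq[of i False j True] by (simp add: f_def)
  qed (rule rot_rot rot_ref ref_rot ref_ref)+
  then show ?thesis by (rule that)
qed

theorem theorem2p3:
  fixes p :: nat
  assumes "Factorial_Ring.prime p"
  shows "real (card (ugraph_edges (intersection_graph (dihedral_group (p ^ 2))))) =
         1 / 2 * (3 * real p ^ 2 + 3 * real p + 2)"
proof -
  \<comment> \<open>Even the smallest prime gives \<open>p^2 = 4\<close>, so the bound
    \<open>n \<ge> 3\<close> always holds.\<close>
  have "2 ^ 2 \<le> p ^ 2"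
    using prime_ge_2_nat[OF assms] by (rule power_mono) simp
  then have "p ^ 2 \<ge> 3" by simp
  then obtain rot ref where "dihedral (dihedral_group (p ^ 2)) (int (p ^ 2)) rot ref"
    by (rule dihedral_dihedral_group)
  then interpret dihedral "dihedral_group (p ^ 2)" "int (p ^ 2)" rot ref .
  have "card (ugraph_edges (intersection_graph (dihedral_group (p ^ 2)))) = (p + 2 choose 2) + p ^ 2"
    using card_edges_prime_square[of "int p"] assms by (simp add: nat_power_eq)
  \<comment> \<open>The division by 2 in \<open>choose_two\<close> is on naturals; it is exact
    because one of two consecutive factors is even.\<close>
  moreover have "real (p + 2 choose 2) = (real p + 2) * (real p + 1) / 2"
    by (simp add: choose_two real_of_nat_div algebra_simps)
  ultimately show ?thesis
    by (simp add: power2_eq_square algebra_simps)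
qed

end
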